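(* Let $r$ and $p$ be positive integers with $p\ge r+1$. Then \[S(2,r;p)=\frac{1}{2!\,(r-1)!}\sum_{k=1}^r\left[\begin{array}{c} r\\ k\end{array}\right]\Big\{W_{3,r-1}(p+1-k)-2H_{r-1}W_{2,r-1}(p+1-k)+\left(H_{r-1}^2+H_{r-1}^{(2)}\right)\zeta(p+1-k)\Big\},\] \[S(3,r;p)=\frac{1}{3!\,(r-1)!}\sum_{k=1}^r\left[\begin{array}{c} r\\ k\end{array}\right]\Big\{W_{4,r-1}(p+1-k)-3H_{r-1}W_{3,r-1}(p+1-k)+3\left(H_{r-1}^2+H_{r-1}^{(2)}\right)W_{2,r-1}(p+1-k)-\left(H_{r-1}^3+3H_{r-1}H_{r-1}^{(2)}+2H_{r-1}^{(3)}\right)\zeta(p+1-k)\Big\}.\]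
   Context: For positive integers $k,m,n$, the generalized hyperharmonic number is \[h_n^{(m)}(k)=\sum_{\substack{1\le n_{m+k-1}<\cdots<n_m\\ \le n_{m-1}\le\cdots\le n_1\le n}}\frac{1}{n_m n_{m+1}\cdots n_{m+k-1}},\] i.e. the sum runs over integers with $1\le n_{m+k-1}<\cdots<n_m\le n_{m-1}\le\cdots\le n_1\le n$; and $h_n^{(m)}(k)=0$ when $n<k$. Define $S(k,m;p)=\sum_{n=1}^\infty h_n^{(m)}(k)/n^p$. For integers $j\ge1$, $N\ge0$, $H_N^{(j)}=\sum_{i=1}^N i^{-j}$ (empty sum $=0$) and $H_N=H_N^{(1)}$; $\zeta$ is the Riemann zeta function. The unsigned Stirling numbers of the first kind are defined by $x(x+1)\cdots(x+n-1)=\sum_{k=0}^{n}\left[\begin{array}{c} n\\ k\end{array}\right]x^k$. For integers $k\ge1$, $r\ge0$, $m\ge2$, define \[W_{k,r}(m)=(k-1)!\sum_{n=1}^\infty\frac{\left[\begin{array}{c} n+r+1\\ k\end{array}\right]}{(n+r)!\,n^m}.\] *)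

theory Defs
  imports "HOL-Analysis.Analysis" "HOL-Combinatorics.Stirling"
begin

text \<open>
  A tuple \<open>n\<^sub>1, \<dots>, n\<^bsub>m+k-1\<^esub>\<close> is encoded as an extensional function on \<open>{1..m+k-1}\<close>.
  The first \<open>m - 1\<close> steps of the chain are weak and the last \<open>k - 1\<close> steps are strict:
  \<open>1 \<le> n\<^bsub>m+k-1\<^esub> < \<dots> < n\<^sub>m \<le> n\<^bsub>m-1\<^esub> \<le> \<dots> \<le> n\<^sub>1 \<le> n\<close>.
  The parameters \<open>m\<close> and \<open>k\<close> are meant to be positive.
\<close>
definition hyperharm_index :: "nat \<Rightarrow> nat \<Rightarrow> nat \<Rightarrow> (nat \<Rightarrow> nat) set" where
  "hyperharm_index n m k =
     {a \<in> {1..m+k-1} \<rightarrow>\<^sub>E {1..n}.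
        (\<forall>i\<in>{1..<m}. a (i+1) \<le> a i) \<and> (\<forall>i\<in>{m..<m+k-1}. a (i+1) < a i)}"

text \<open>\<open>hyperharm n m k\<close> is \<open>h\<^sub>n\<^sup>(\<^sup>m\<^sup>)(k)\<close>.\<close>
definition hyperharm :: "nat \<Rightarrow> nat \<Rightarrow> nat \<Rightarrow> real" where
  "hyperharm n m k = (\<Sum>a\<in>hyperharm_index n m k. 1 / (\<Prod>i=m..m+k-1. real (a i)))"

lemma hyperharm_eq_0:
  assumes "m \<ge> 1" "n < k"
  shows "hyperharm n m k = 0"
proof -
  have False if a: "a \<in> hyperharm_index n m k" for a
  proof -
    have "a (m + j) + j \<le> n" if "j < k" for j
      using that
    proof (induction j)
      case 0
      then have "a m \<in> {1..n}"
        using a assms by (auto simp: hyperharm_index_def PiE_def Pi_def)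
      then show ?case by simp
    next
      case (Suc j)
      then have "m + j \<in> {m..<m+k-1}" by auto
      then have "a (m + j + 1) < a (m + j)"
        using a unfolding hyperharm_index_def by blast
      then show ?case using Suc by auto
    qed
    from this[of "k - 1"] have "a (m + (k - 1)) + (k - 1) \<le> n"
      using assms by auto
    moreover have "a (m + (k - 1)) \<in> {1..n}"
      using a assms by (auto simp: hyperharm_index_def PiE_def Pi_def)
    ultimately show False using assms by auto
  qed
  then have "hyperharm_index n m k = {}" by blast
  then show ?thesis by (simp add: hyperharm_def)
qed

text \<open>All series over \<open>n \<ge> 1\<close> below are written with summation index shifted by one.\<close>

definition hyperharm_sum :: "nat \<Rightarrow> nat \<Rightarrow> nat \<Rightarrow> real" where
  "hyperharm_sum k m p = (\<Sum>n. hyperharm (Suc n) m k / real (Suc n) ^ p)"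

text \<open>\<open>gen_harm j N\<close> is \<open>H\<^sub>N\<^sup>(\<^sup>j\<^sup>)\<close>; for \<open>j = 1\<close> it is the library's \<^const>\<open>harm\<close>.\<close>
definition gen_harm :: "nat \<Rightarrow> nat \<Rightarrow> real" where
  "gen_harm j N = (\<Sum>i=1..N. 1 / real i ^ j)"

lemma gen_harm_1: "gen_harm 1 N = harm N"
  by (simp add: gen_harm_def harm_def divide_inverse)

text \<open>The Riemann zeta function on the half-line \<open>s > 1\<close>, where its Dirichlet series converges.\<close>
definition zeta :: "real \<Rightarrow> real" where
  "zeta s = (\<Sum>n. 1 / real (Suc n) powr s)"

text \<open>
  \<^const>\<open>stirling\<close> gives the unsigned Stirling numbers of the first kind; their defining
  generating polynomial is the library fact \<open>stirling_pochhammer\<close>.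
  The series is meant for \<open>k \<ge> 1\<close> and \<open>m \<ge> 2\<close>.
\<close>
definition W :: "nat \<Rightarrow> nat \<Rightarrow> nat \<Rightarrow> real" where
  "W k r m = fact (k - 1) *
     (\<Sum>n. real (stirling (Suc n + r + 1) k) / (fact (Suc n + r) * real (Suc n) ^ m))"

end

theory Submission
  imports Defs
begin

text \<open>
  The hyperharmonic number \<open>h\<^sub>n\<^sup>(\<^sup>r\<^sup>)(k)\<close> is the coefficient of \<open>X\<^sup>k\<close> in \<open>(r + X)\<^sub>n / n!\<close>, where \<open>(\<cdot>)\<^sub>n\<close> is
  the rising factorial. Since \<open>(r + X)\<^sub>n = (1 + X)\<^bsub>n+r-1\<^esub> / (1 + X)\<^bsub>r-1\<^esub>\<close>, it is a convolution of the
  Stirling numbers of \<open>n + r\<close> (numerator) with the signed complete homogeneous symmetric functions of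
  \<open>1, 1/2, \<dots>, 1/(r-1)\<close> (inverse denominator), which are polynomials in the harmonic numbers.
  Writing \<open>1/n!\<close> as \<open>(n+1)\<cdots>(n+r-1) / (n+r-1)!\<close> and expanding the numerator in powers of \<open>n\<close> by
  Stirling numbers of \<open>r\<close> turns the sum over \<open>n\<close> into a combination of the series \<open>W\<close>.
\<close>

section \<open>Recurrences for hyperharmonic numbers\<close>

lemma hyperharm_index_antimono:
  assumes "a \<in> hyperharm_index n m k" "1 \<le> i" "i \<le> j" "j \<le> m + k - 1"
  shows "a j \<le> a i"
  using assms(3,4)
proof (induction j rule: dec_induct)
  case (step j)
  have "a (Suc j) \<le> a j"
  proof (cases "j < m")
    case True
    then show ?thesis using assms(1,2) step by (auto simp: hyperharm_index_def)
  next
    case False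
    then have "j \<in> {m..<m+k-1}" using step by auto
    then have "a (j + 1) < a j" using assms(1) unfolding hyperharm_index_def by blast
    then show ?thesis by simp
  qed
  then show ?case using step by simp
qed simp

lemma finite_hyperharm_index [simp]: "finite (hyperharm_index n m k)"
  unfolding hyperharm_index_def by (auto intro!: finite_PiE)

lemma hyperharm_indexI:
  assumes "m + k - 1 = L" "a \<in> extensional {1..L}" "\<And>i. i \<in> {1..L} \<Longrightarrow> a i \<in> {1..n}"
    and "\<And>i. i \<in> {1..<m} \<Longrightarrow> a (Suc i) \<le> a i" "\<And>i. i \<in> {m..<L} \<Longrightarrow> a (Suc i) < a i"
  shows "a \<in> hyperharm_index n m k"
  using assms by (simp add: hyperharm_index_def PiE_def Pi_def)

text \<open>Tuples are sorted by whether their largest entry \<open>a 1\<close> attains the new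
  bound. The chain decreases, so \<open>a 1 \<le> n\<close> bounds every entry by \<open>n\<close>.
  The assumption makes 1 an actual position of the tuple.\<close>

lemma hyperharm_index_Suc:
  assumes "m + k \<ge> 2"
  shows "hyperharm_index (Suc n) m k =
           hyperharm_index n m k \<union> {a \<in> hyperharm_index (Suc n) m k. a 1 = Suc n}"
proof (intro equalityI subsetI)
  fix a assume a: "a \<in> hyperharm_index (Suc n) m k"
  show "a \<in> hyperharm_index n m k \<union> {a \<in> hyperharm_index (Suc n) m k. a 1 = Suc n}"
  proof (cases "a 1 = Suc n")
    case False
    have "a 1 \<in> {1..Suc n}"
      using a assms by (auto simp: hyperharm_index_def PiE_def Pi_def)
    with False have "a 1 \<le> n" by auto
    then have "a i \<le> n" if "1 \<le> i" "i \<le> m + k - 1" for i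
      using hyperharm_index_antimono[OF a, of 1 i] that by simp
    then show ?thesis
      using a by (auto simp: hyperharm_index_def PiE_def Pi_def)
  qed (use a in auto)
qed (auto simp: hyperharm_index_def PiE_def Pi_def le_Suc_eq)

lemma hyperharm_Suc:
  assumes "m + k \<ge> 2"
  shows "hyperharm (Suc n) m k = hyperharm n m k +
           (\<Sum>a | a \<in> hyperharm_index (Suc n) m k \<and> a 1 = Suc n. 1 / (\<Prod>i=m..m+k-1. real (a i)))"
proof -
  have "hyperharm_index n m k \<inter> {a \<in> hyperharm_index (Suc n) m k. a 1 = Suc n} = {}"
    using assms by (auto simp: hyperharm_index_def PiE_def Pi_def)
  then show ?thesis
    unfolding hyperharm_def by (subst hyperharm_index_Suc[OF assms]) (auto intro!: sum.union_disjoint)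
qed

text \<open>For \<open>m = 1\<close> all steps are strict and every entry occurs in the product.
  Removing a leading entry \<open>Suc n\<close> leaves a chain bounded by \<open>n\<close> and
  splits off the factor \<open>1 / Suc n\<close>.\<close>

lemma hyperharm_1_Suc_Suc:
  "hyperharm (Suc n) 1 (Suc k) = hyperharm n 1 (Suc k) + hyperharm n 1 k / real (Suc n)"
proof -
  \<comment> \<open>\<open>?s\<close> drops the leading entry and shifts the positions down;
    \<open>?t\<close> puts \<open>Suc n\<close> in front again. The restrictions keep both maps
    within extensional functions.\<close>
  let ?s = "\<lambda>a. restrict (\<lambda>i. a (Suc i)) {1..k}"
  let ?t = "\<lambda>b. restrict (\<lambda>i. if i = 1 then Suc n else b (i - 1)) {1..Suc k}"
  have "(\<Sum>a | a \<in> hyperharm_index (Suc n) 1 (Suc k) \<and> a 1 = Suc n. 1 / (\<Prod>i=1..Suc k. real (a i))) =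
        (\<Sum>b\<in>hyperharm_index n 1 k. 1 / (\<Prod>i=1..k. real (b i)) / real (Suc n))"
  proof (rule sum.reindex_bij_witness[of _ ?t ?s])
    fix a assume "a \<in> {a. a \<in> hyperharm_index (Suc n) 1 (Suc k) \<and> a 1 = Suc n}"
    then have a: "a \<in> hyperharm_index (Suc n) 1 (Suc k)" and a1: "a 1 = Suc n" by auto
    have ext: "a \<in> extensional {1..Suc k}" and pos: "\<And>i. i \<in> {1..Suc k} \<Longrightarrow> a i \<ge> 1"
      and dec: "\<And>i. i \<in> {1..k} \<Longrightarrow> a (Suc i) < a i"
      using a by (auto simp: hyperharm_index_def PiE_def Pi_def)
    show "?t (?s a) = a"
    proof
      fix i show "?t (?s a) i = a i"
        using ext a1 by (auto simp: extensional_def restrict_def)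
    qed
    have "a (Suc i) \<le> n" if "i \<in> {1..k}" for i
      using hyperharm_index_antimono[OF a, of 1 i] dec[OF that] a1 that by simp
    then show "?s a \<in> hyperharm_index n 1 k"
      using pos dec by (auto simp: hyperharm_index_def PiE_def Pi_def)
    have "(\<Prod>i=1..Suc k. real (a i)) = real (Suc n) * (\<Prod>i=1..k. real (?s a i))"
      using a1 by (simp add: prod.atLeast_Suc_atMost prod.atLeast_Suc_atMost_Suc_shift del: prod.cl_ivl_Suc)
    then show "1 / (\<Prod>i=1..k. real (?s a i)) / real (Suc n) = 1 / (\<Prod>i=1..Suc k. real (a i))"
      by (simp add: mult.commute del: of_nat_Suc)
  next
    fix b assume b: "b \<in> hyperharm_index n 1 k"
    have ext: "b \<in> extensional {1..k}" and ran: "\<And>i. i \<in> {1..k} \<Longrightarrow> b i \<ge> 1 \<and> b i \<le> n"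
      and dec: "\<And>i. i \<in> {1..<k} \<Longrightarrow> b (Suc i) < b i"
      using b by (auto simp: hyperharm_index_def PiE_def Pi_def)
    show "?s (?t b) = b"
    proof
      fix i show "?s (?t b) i = b i"
        using ext by (auto simp: extensional_def restrict_def)
    qed
    have strict': "?t b (Suc i) < ?t b i" if "i \<in> {1..k}" for i
    proof (cases "i = 1")
      case True
      then show ?thesis using ran[of 1] that by auto
    next
      case False
      then have "i - 1 \<in> {1..<k}" "Suc (i - 1) = i" using that by auto
      then show ?thesis using dec[of "i - 1"] that False by simp
    qed
    have range': "?t b i \<in> {1..Suc n}" if i: "i \<in> {1..Suc k}" for i
    proof (cases "i = 1")
      case False
      then have "i - 1 \<in> {1..k}" using i by auto
      then show ?thesis using ran[of "i - 1"] i by simp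
    qed (use i in auto)
    have "?t b \<in> hyperharm_index (Suc n) 1 (Suc k)"
      by (rule hyperharm_indexI[OF _ restrict_extensional range' _ strict']) auto
    then show "?t b \<in> {a. a \<in> hyperharm_index (Suc n) 1 (Suc k) \<and> a 1 = Suc n}"
      by simp
  qed
  then show ?thesis
    using hyperharm_Suc[of 1 "Suc k" n]
    by (simp add: hyperharm_def sum_divide_distrib del: of_nat_Suc prod.cl_ivl_Suc)
qed

text \<open>For order \<open>Suc m\<close> with \<open>m \<ge> 1\<close> the first step is weak and
  the first entry lies outside the product. Removing a leading \<open>Suc n\<close> thus leaves the
  weight unchanged and the bound at \<open>Suc n\<close>, not \<open>n\<close>.\<close>

lemma hyperharm_Suc_Suc:
  assumes "m \<ge> 1" "k \<ge> 1"
  shows "hyperharm (Suc n) (Suc m) k = hyperharm n (Suc m) k + hyperharm (Suc n) m k"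
proof -
  let ?s = "\<lambda>a. restrict (\<lambda>i. a (Suc i)) {1..m+k-1}"
  let ?t = "\<lambda>b. restrict (\<lambda>i. if i = 1 then Suc n else b (i - 1)) {1..m+k}"
  have "(\<Sum>a | a \<in> hyperharm_index (Suc n) (Suc m) k \<and> a 1 = Suc n. 1 / (\<Prod>i=Suc m..m+k. real (a i))) =
        (\<Sum>b\<in>hyperharm_index (Suc n) m k. 1 / (\<Prod>i=m..m+k-1. real (b i)))"
  proof (rule sum.reindex_bij_witness[of _ ?t ?s])
    fix a assume "a \<in> {a. a \<in> hyperharm_index (Suc n) (Suc m) k \<and> a 1 = Suc n}"
    then have a: "a \<in> hyperharm_index (Suc n) (Suc m) k" and a1: "a 1 = Suc n" by auto
    have ext: "a \<in> extensional {1..m+k}" and ran: "\<And>i. i \<in> {1..m+k} \<Longrightarrow> a i \<ge> 1 \<and> a i \<le> Suc n"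
      and weak: "\<And>i. i \<in> {1..<Suc m} \<Longrightarrow> a (Suc i) \<le> a i"
      and strict: "\<And>i. i \<in> {Suc m..<m+k} \<Longrightarrow> a (Suc i) < a i"
      using a by (auto simp: hyperharm_index_def PiE_def Pi_def)
    show "?t (?s a) = a"
    proof
      fix i show "?t (?s a) i = a i"
        using ext a1 by (auto simp: extensional_def restrict_def)
    qed
    have range': "?s a i \<in> {1..Suc n}" if "i \<in> {1..m+k-1}" for i
      using ran[of "Suc i"] that by auto
    have weak': "?s a (Suc i) \<le> ?s a i" if "i \<in> {1..<m}" for i
      using weak[of "Suc i"] that assms by auto
    have strict': "?s a (Suc i) < ?s a i" if "i \<in> {m..<m+k-1}" for i
      using strict[of "Suc i"] that assms by auto
    show "?s a \<in> hyperharm_index (Suc n) m k"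
      by (rule hyperharm_indexI[OF _ restrict_extensional range' weak' strict']) auto
    have "(\<Prod>i=Suc m..m+k. real (a i)) = (\<Prod>i=m..m+k-1. real (a (Suc i)))"
      using assms by (cases k) (auto simp: prod.atLeast_Suc_atMost_Suc_shift simp del: prod.cl_ivl_Suc)
    also have "\<dots> = (\<Prod>i=m..m+k-1. real (?s a i))"
      using assms by (intro prod.cong) auto
    finally show "1 / (\<Prod>i=m..m+k-1. real (?s a i)) = 1 / (\<Prod>i=Suc m..m+k. real (a i))"
      by simp
  next
    fix b assume b: "b \<in> hyperharm_index (Suc n) m k"
    have ext: "b \<in> extensional {1..m+k-1}"
      and ran: "\<And>i. i \<in> {1..m+k-1} \<Longrightarrow> b i \<ge> 1 \<and> b i \<le> Suc n"
      and weak: "\<And>i. i \<in> {1..<m} \<Longrightarrow> b (Suc i) \<le> b i"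
      and strict: "\<And>i. i \<in> {m..<m+k-1} \<Longrightarrow> b (Suc i) < b i"
      using b by (auto simp: hyperharm_index_def PiE_def Pi_def)
    show "?s (?t b) = b"
    proof
      fix i show "?s (?t b) i = b i"
        using ext by (auto simp: extensional_def restrict_def)
    qed
    have weak': "?t b (Suc i) \<le> ?t b i" if "i \<in> {1..<Suc m}" for i
    proof (cases "i = 1")
      case True
      then show ?thesis using ran[of 1] that assms by auto
    next
      case False
      then have "i - 1 \<in> {1..<m}" "Suc (i - 1) = i" using that by auto
      then show ?thesis using weak[of "i - 1"] that False assms by auto
    qed
    have strict': "?t b (Suc i) < ?t b i" if i: "i \<in> {Suc m..<m+k}" for i
    proof -
      have "i - 1 \<in> {m..<m+k-1}" "Suc (i - 1) = i" using i by auto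
      then show ?thesis using strict[of "i - 1"] i assms by auto
    qed
    have range': "?t b i \<in> {1..Suc n}" if i: "i \<in> {1..m+k}" for i
    proof (cases "i = 1")
      case False
      then have "i - 1 \<in> {1..m+k-1}" using i by auto
      then show ?thesis using ran[of "i - 1"] i by simp
    qed (use i in auto)
    have "?t b \<in> hyperharm_index (Suc n) (Suc m) k"
      by (rule hyperharm_indexI[OF _ restrict_extensional range' weak' strict']) auto
    then show "?t b \<in> {a. a \<in> hyperharm_index (Suc n) (Suc m) k \<and> a 1 = Suc n}"
      using assms by simp
  qed
  then show ?thesis
    using assms hyperharm_Suc[of "Suc m" k n]
    by (simp add: hyperharm_def del: prod.cl_ivl_Suc)
qed

section \<open>Generating functions\<close>

text \<open>The tuple has no positions here, so the sum consists of one empty product. This value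
  gives the constant coefficient below and starts the recurrence for \<open>m = 1\<close>.\<close>

lemma hyperharm_1_0: "hyperharm n 1 0 = 1"
proof -
  have "hyperharm_index n 1 0 = {\<lambda>_. undefined}"
    by (auto simp: hyperharm_index_def)
  then show ?thesis by (simp add: hyperharm_def)
qed

text \<open>The next factor of the rising factorial is \<open>n + 1 + X\<close>. After division by
  \<open>(n + 1)!\<close>, comparing coefficients gives the recurrence
  \<open>hyperharm_1_Suc_Suc\<close>.\<close>

lemma hyperharm_1_conv_fps:
  "hyperharm n 1 k = fps_nth (pochhammer (1 + fps_X) n) k / fact n"
proof (induction n arbitrary: k)
  case 0
  then show ?case by (cases k) (auto simp: hyperharm_1_0[unfolded One_nat_def] hyperharm_eq_0)
next
  case (Suc n)
  have *: "(pochhammer (1 + fps_X) (Suc n) :: real fps) =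
      fps_const (real (Suc n)) * pochhammer (1 + fps_X) n + fps_X * pochhammer (1 + fps_X) n"
    by (simp add: pochhammer_Suc algebra_simps flip: fps_of_nat fps_const_add)
  show ?case
  proof (cases k)
    case 0
    have "fps_nth (pochhammer (1 + fps_X) n :: real fps) 0 = fact n"
      using Suc[of 0] by (simp add: hyperharm_1_0[unfolded One_nat_def])
    then show ?thesis unfolding * 0 by (simp add: hyperharm_1_0 del: One_nat_def)
  next
    case (Suc j)
    then show ?thesis unfolding * Suc hyperharm_1_Suc_Suc Suc.IH
      by (simp add: field_simps del: of_nat_Suc)
  qed
qed

text \<open>Induction on \<open>m\<close>, and within it on \<open>n\<close>, following
  \<open>hyperharm_Suc_Suc\<close>. With \<open>k = 0\<close> and \<open>m \<ge> 2\<close> the weak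
  chain condition would refer to position \<open>m\<close>, outside the tuple.\<close>

lemma hyperharm_conv_fps:
  assumes "m \<ge> 1" "k \<ge> 1"
  shows "hyperharm n m k = fps_nth (pochhammer (of_nat m + fps_X) n) k / fact n"
  using assms(1)
proof (induction m arbitrary: n rule: nat_induct_at_least)
  case base
  show ?case using hyperharm_1_conv_fps[of n k] by simp
next
  case (Suc m)
  show ?case
  proof (induction n)
    case 0
    then show ?case using assms(2) by (simp add: hyperharm_eq_0)
  next
    case (Suc n)
    \<comment> \<open>Both rising factorials of length \<open>Suc n\<close> contain the one of
      length \<open>n\<close> starting at \<open>m + 1 + X\<close>. The remaining factors
      \<open>m + 1 + n + X\<close> and \<open>m + X\<close> differ by \<open>n + 1\<close>.\<close>
    have "(pochhammer (of_nat (Suc m) + fps_X) (Suc n) :: real fps) =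
        fps_const (real (Suc n)) * pochhammer (of_nat (Suc m) + fps_X) n
        + pochhammer (of_nat m + fps_X) (Suc n)"
      unfolding pochhammer_rec[of "of_nat m + fps_X" n]
      by (simp add: pochhammer_Suc algebra_simps flip: fps_of_nat fps_const_add)
    then have "fps_nth (pochhammer (of_nat (Suc m) + fps_X) (Suc n) :: real fps) k =
        real (Suc n) * fps_nth (pochhammer (of_nat (Suc m) + fps_X) n) k
        + fps_nth (pochhammer (of_nat m + fps_X) (Suc n)) k"
      by simp
    then show ?case
      unfolding hyperharm_Suc_Suc[OF \<open>m \<ge> 1\<close> assms(2)] Suc.IH \<open>\<And>n. hyperharm n m k = _\<close>[of "Suc n"]
      by (simp add: add_divide_distrib del: of_nat_Suc)
  qed
qed

text \<open>The rising factorial of \<open>X\<close> of length \<open>n + 1\<close> is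
  \<open>X\<close> times that of \<open>1 + X\<close> of length \<open>n\<close>; hence both
  Stirling arguments are shifted by one.\<close>

lemma fps_nth_pochhammer_conv_stirling:
  "fps_nth (pochhammer (1 + fps_X) n :: 'a :: comm_ring_1 fps) k = of_nat (stirling (Suc n) (Suc k))"
proof (induction n arbitrary: k)
  case 0
  then show ?case by (cases k) auto
next
  case (Suc n)
  have *: "(pochhammer (1 + fps_X) (Suc n) :: 'a fps) =
      fps_const (of_nat (Suc n)) * pochhammer (1 + fps_X) n + fps_X * pochhammer (1 + fps_X) n"
    by (simp add: pochhammer_Suc algebra_simps flip: fps_of_nat fps_const_add)
  show ?case
    unfolding * by (cases k) (simp_all add: Suc stirling.simps(4)[of "Suc n"] distrib_right del: stirling.simps(4))
qed

section \<open>The inverse rising factorial and its first coefficients\<close>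

text \<open>
  The coefficient of \<open>X\<^sup>j\<close> is \<open>(-1)\<^sup>j\<close> times the complete homogeneous symmetric polynomial of degree \<open>j\<close>
  in \<open>1, 1/2, \<dots>, 1/N\<close>.
\<close>
definition harm_fps :: "nat \<Rightarrow> real fps" where
  "harm_fps N = fps_const (fact N) * inverse (pochhammer (1 + fps_X) N)"

lemma fps_nth_pochhammer_0: "fps_nth (pochhammer (1 + fps_X) n :: real fps) 0 = fact n"
  using stirling_Suc_n_1[of n] by (simp add: fps_nth_pochhammer_conv_stirling)

lemma pochhammer_mult_harm_fps:
  "pochhammer (1 + fps_X) N * harm_fps N = fps_const (fact N)"
proof -
  have "pochhammer (1 + fps_X) N * inverse (pochhammer (1 + fps_X) N :: real fps) = 1"
    by (rule inverse_mult_eq_1') (simp add: fps_nth_pochhammer_0)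
  then show ?thesis by (simp add: harm_fps_def mult.left_commute)
qed

lemma harm_fps_0: "harm_fps 0 = 1"
  by (simp add: harm_fps_def)

text \<open>\<open>harm_fps N\<close> is the product of the series \<open>1 / (1 + X/i)\<close> for
  \<open>i = 1..N\<close>; the new factor is cleared from the denominator.\<close>

lemma harm_fps_Suc:
  "harm_fps (Suc N) * (1 + fps_const (1 / real (Suc N)) * fps_X) = harm_fps N"
proof -
  let ?P = "\<lambda>n. pochhammer (1 + fps_X) n :: real fps"
  have P: "?P (Suc N) = ?P N * (fps_const (real (Suc N)) * (1 + fps_const (1 / real (Suc N)) * fps_X))"
    by (simp add: pochhammer_Suc distrib_left mult.assoc[symmetric] flip: fps_of_nat)
       (simp add: algebra_simps flip: fps_const_add)
  have "?P N * fps_const (real (Suc N)) * (harm_fps (Suc N) * (1 + fps_const (1 / real (Suc N)) * fps_X)) =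
        ?P (Suc N) * harm_fps (Suc N)"
    unfolding P by (simp only: mult_ac)
  also have "\<dots> = ?P N * fps_const (real (Suc N)) * harm_fps N"
    by (simp add: pochhammer_mult_harm_fps mult.assoc[symmetric] mult.commute[of _ "fps_const _"] del: of_nat_Suc)
       (simp add: mult.assoc pochhammer_mult_harm_fps)
  \<comment> \<open>The common factor can be cancelled: the constant coefficient of
    \<open>?P N\<close> is \<open>fact N\<close>, so it is a nonzero element of an integral
    domain.\<close>
  finally show ?thesis
    using fps_nth_pochhammer_0[of N] by auto
qed

lemma harm_fps_nth_0 [simp]: "fps_nth (harm_fps N) 0 = 1"
  by (simp add: harm_fps_def fps_nth_pochhammer_0)

lemma harm_fps_nth_Suc:
  "fps_nth (harm_fps (Suc N)) (Suc j) =
     fps_nth (harm_fps N) (Suc j) - fps_nth (harm_fps (Suc N)) j / real (Suc N)"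
proof -
  have "fps_nth (harm_fps N) (Suc j) = fps_nth (harm_fps (Suc N)) (Suc j) + 
          fps_nth (harm_fps (Suc N)) j / real (Suc N)"
    by (subst harm_fps_Suc[symmetric]) (simp add: distrib_left mult.assoc[symmetric] del: of_nat_Suc)
  then show ?thesis by simp
qed

lemma gen_harm_0 [simp]: "gen_harm j 0 = 0"
  by (simp add: gen_harm_def)

lemma gen_harm_Suc: "gen_harm j (Suc N) = gen_harm j N + 1 / real (Suc N) ^ j"
  by (simp add: gen_harm_def)

text \<open>This and the next two lemmas express complete homogeneous symmetric polynomials by power
  sums, as Newton's identities do, with sign \<open>(-1)^j\<close>. Each is proved by induction on
  \<open>N\<close> from the coefficient of one degree lower.\<close>

lemma harm_fps_nth_1: "fps_nth (harm_fps N) 1 = - harm N"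
proof (induction N)
  case (Suc N)
  then show ?case
    using harm_fps_nth_Suc[of N 0] by (simp add: harm_Suc divide_inverse)
qed (simp add: harm_fps_0 harm_def)

lemma harm_fps_nth_2: "fps_nth (harm_fps N) 2 = (harm N ^ 2 + gen_harm 2 N) / 2"
proof (induction N)
  case (Suc N)
  have "inverse (real (Suc N)) = 1 / real (Suc N)" by (simp add: divide_inverse)
  then show ?case
    using harm_fps_nth_Suc[of N 1] Suc harm_fps_nth_1[of "Suc N"]
    by (simp add: harm_Suc gen_harm_Suc numeral_2_eq_2[symmetric] del: of_nat_Suc)
       (simp add: field_simps power2_eq_square del: of_nat_Suc)
qed (simp add: harm_fps_0 harm_def)

lemma harm_fps_nth_3:
  "fps_nth (harm_fps N) 3 =
     - (harm N ^ 3 + 3 * harm N * gen_harm 2 N + 2 * gen_harm 3 N) / 6"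
proof (induction N)
  case (Suc N)
  have "inverse (real (Suc N)) = 1 / real (Suc N)" by (simp add: divide_inverse)
  then show ?case
    using harm_fps_nth_Suc[of N 2] Suc harm_fps_nth_2[of "Suc N"]
    by (simp add: harm_Suc gen_harm_Suc numeral_3_eq_3[symmetric] del: of_nat_Suc)
       (simp add: field_simps power2_eq_square power3_eq_cube del: of_nat_Suc)
qed (simp add: harm_fps_0 harm_def)

lemma hyperharm_conv_stirling:
  assumes "r \<ge> 1" "k \<ge> 1"
  shows "hyperharm n r k =
    (\<Sum>j\<le>k. fps_nth (harm_fps (r - 1)) j * real (stirling (n + r) (Suc k - j))) / (fact n * fact (r - 1))"
proof -
  have "pochhammer (1 + fps_X) (n + r - 1) =
          pochhammer (1 + fps_X) (r - 1) * (pochhammer (of_nat r + fps_X) n :: real fps)"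
    using pochhammer_product'[of "1 + fps_X :: real fps" "r - 1" n] assms
    by (simp add: of_nat_diff algebra_simps)
  \<comment> \<open>Multiplying by \<open>harm_fps (r - 1)\<close> turns the factor of length
    \<open>r - 1\<close> into the constant \<open>fact (r - 1)\<close>.\<close>
  then have "fps_const (fact (r - 1)) * pochhammer (of_nat r + fps_X) n =
          harm_fps (r - 1) * pochhammer (1 + fps_X) (n + r - 1)"
    using pochhammer_mult_harm_fps[of "r - 1"] by (metis mult.commute mult.assoc)
  then have "fact (r - 1) * fps_nth (pochhammer (of_nat r + fps_X) n) k =
      fps_nth (harm_fps (r - 1) * pochhammer (1 + fps_X) (n + r - 1)) k"
    by (metis fps_mult_left_const_nth)
  also have "\<dots> = (\<Sum>j\<le>k. fps_nth (harm_fps (r - 1)) j * real (stirling (n + r) (Suc k - j)))"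
    unfolding fps_mult_nth atMost_atLeast0 using assms
    by (intro sum.cong) (auto simp: fps_nth_pochhammer_conv_stirling Suc_diff_le)
  finally show ?thesis
    using assms by (simp add: hyperharm_conv_fps field_simps)
qed

section \<open>Summation over \<open>n\<close>\<close>

text \<open>A crude bound suffices: against \<open>n ^ m\<close> with \<open>m \<ge> 2\<close>, a
  square root still leaves a summable power. The base 4 lets the growth of the square root absorb
  the second term of the Stirling recurrence.\<close>

lemma stirling_le_sqrt:
  "real (stirling (Suc n) (Suc k)) \<le> 4 ^ k * sqrt (real (Suc n)) * fact n"
proof (induction n arbitrary: k)
  case 0
  then show ?case by (cases k) auto
next
  case (Suc n)
  show ?case
  proof (cases k)
    case 0
    have "stirling (Suc (Suc n)) (Suc 0) = fact (Suc n)"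
      by (rule stirling_Suc_n_1)
    moreover have "(1::real) \<le> sqrt (real (Suc (Suc n)))" by simp
    ultimately show ?thesis 
      unfolding 0 by (simp del: of_nat_Suc fact_Suc stirling.simps)
  next
    case (Suc j)
    define a b where "a = sqrt (real (Suc n))" and "b = sqrt (real (Suc (Suc n)))"
    have a: "a \<ge> 1" "a ^ 2 = real (Suc n)" by (auto simp: a_def)
    have b: "b \<ge> 1" "b ^ 2 = real (Suc n) + 1" by (auto simp: b_def)
    \<comment> \<open>Absorption amounts to \<open>4 * a * (b - a) \<ge> 1\<close>. As
      \<open>(b + a) * (b - a) = 1\<close>, this follows from
      \<open>b + a \<le> 4 * a\<close>.\<close>
    have "b \<le> 3 * a"
      by (rule power2_le_imp_le) (use a b in \<open>auto simp: power_mult_distrib\<close>)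
    then have "4 * a * (b - a) \<ge> (b + a) * (b - a)"
      using a by (intro mult_right_mono) (auto simp: a_def b_def)
    moreover have "(b + a) * (b - a) = 1"
      using a b by (simp add: algebra_simps power2_eq_square)
    ultimately have "a * (1 + 4 * a * a) \<le> a * (4 * a * b)"
      using a by (intro mult_left_mono) (auto simp: algebra_simps)
    then have ab: "4 * real (Suc n) * a + a \<le> 4 * real (Suc n) * b"
      unfolding a(2)[symmetric] by (simp add: power2_eq_square algebra_simps)
    have "real (stirling (Suc (Suc n)) (Suc k)) =
        real (Suc n) * real (stirling (Suc n) (Suc k)) + real (stirling (Suc n) (Suc j))"
      unfolding Suc stirling.simps(4)[of "Suc n"] by (simp only: of_nat_add of_nat_mult)
    also have "\<dots> \<le> real (Suc n) * (4 ^ k * a * fact n) + 4 ^ j * a * fact n"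
      unfolding a_def by (intro add_mono mult_left_mono Suc.IH) auto
    also have "\<dots> = 4 ^ j * fact n * (4 * real (Suc n) * a + a)"
      by (simp add: Suc algebra_simps)
    also have "\<dots> \<le> 4 ^ j * fact n * (4 * real (Suc n) * b)"
      using ab by (intro mult_left_mono) auto
    also have "\<dots> = 4 ^ k * b * fact (Suc n)"
      by (simp add: Suc fact_Suc algebra_simps del: of_nat_Suc)
    finally show ?thesis by (simp add: b_def)
  qed
qed

lemma summable_W:
  assumes "k \<ge> 1" "m \<ge> 2"
  shows "summable (\<lambda>n. real (stirling (Suc n + r + 1) k) / (fact (Suc n + r) * real (Suc n) ^ m))"
proof (rule summable_comparison_test_ev)
  have "summable (\<lambda>n. real n powr (-3/2))"
    by (subst summable_real_powr_iff) auto
  then have "summable (\<lambda>n. real (Suc n) powr (-3/2))"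
    by (subst summable_Suc_iff)
  then show "summable (\<lambda>n. 4 ^ (k - 1) * sqrt (real (r + 2)) * real (Suc n) powr (-3/2))"
    by (intro summable_mult)
  show "\<forall>\<^sub>F n in sequentially.
      norm (real (stirling (Suc n + r + 1) k) / (fact (Suc n + r) * real (Suc n) ^ m))
        \<le> 4 ^ (k - 1) * sqrt (real (r + 2)) * real (Suc n) powr (-3/2)"
  proof (intro always_eventually allI)
    fix n
    let ?x = "real (Suc n)"
    have "real (stirling (Suc n + r + 1) k) \<le> 4 ^ (k - 1) * sqrt (real (Suc (Suc n + r))) * fact (Suc n + r)"
      using stirling_le_sqrt[of "Suc n + r" "k - 1"] assms by (simp del: stirling.simps of_nat_Suc fact_Suc)
    \<comment> \<open>This moves the dependence on \<open>r\<close> into a constant, leaving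
      \<open>?x powr (1/2 - 2)\<close> after division.\<close>
    also have "sqrt (real (Suc (Suc n + r))) \<le> sqrt (real (r + 2) * ?x)"
      by (rule real_sqrt_le_mono) (simp add: algebra_simps)
    also have "\<dots> = sqrt (real (r + 2)) * ?x powr (1/2)"
      by (simp only: real_sqrt_mult powr_half_sqrt of_nat_0_le_iff)
    finally have 1: "real (stirling (Suc n + r + 1) k) \<le>
        4 ^ (k - 1) * (sqrt (real (r + 2)) * ?x powr (1/2)) * fact (Suc n + r)"
      by (simp del: stirling.simps of_nat_Suc fact_Suc)
    have "norm (real (stirling (Suc n + r + 1) k) / (fact (Suc n + r) * ?x ^ m))
        = real (stirling (Suc n + r + 1) k) / fact (Suc n + r) / ?x ^ m"
      by (simp del: stirling.simps of_nat_Suc fact_Suc)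
    also have "\<dots> \<le> 4 ^ (k - 1) * (sqrt (real (r + 2)) * ?x powr (1/2)) / ?x ^ 2"
      using 1 assms by (intro frac_le power_increasing) 
         (simp_all add: divide_le_eq del: stirling.simps fact_Suc)
    also have "\<dots> = 4 ^ (k - 1) * sqrt (real (r + 2)) * (?x powr (1/2) / ?x powr 2)"
      by (simp add: powr_numeral del: of_nat_Suc)
    also have "?x powr (1/2) / ?x powr 2 = ?x powr (-3/2)"
      by (subst powr_diff[symmetric]) simp
    finally show "norm (real (stirling (Suc n + r + 1) k) / (fact (Suc n + r) * ?x ^ m))
        \<le> 4 ^ (k - 1) * sqrt (real (r + 2)) * ?x powr (-3/2)" .
  qed
qed

text \<open>The Stirling number equals the factorial in the denominator, so \<open>r\<close> drops
  out. This is the source of the zeta values in the theorem.\<close>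

lemma W_1: "W 1 r m = zeta (real m)"
proof -
  have "real (stirling (Suc (Suc n + r)) (Suc 0)) = fact (Suc n + r)" for n
    by (simp only: stirling_Suc_n_1 of_nat_fact)
  then show ?thesis
    by (simp add: W_def zeta_def powr_realpow del: stirling.simps fact_Suc of_nat_Suc)
qed

lemma W_sums:
  assumes "k \<ge> 1" "m \<ge> 2"
  shows "(\<lambda>n. real (stirling (Suc n + r + 1) k) / (fact (Suc n + r) * real (Suc n) ^ m)) 
           sums (W k r m / fact (k - 1))"
  using summable_sums[OF summable_W[OF assms]] by (simp add: W_def)

section \<open>Reduction of the hyperharmonic series to \<open>W\<close>\<close>

lemma inverse_fact_conv_stirling:
  assumes "r \<ge> 1" "n \<ge> 1" "p \<ge> r"
  shows "1 / (fact n * real n ^ p) =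
           (\<Sum>k=1..r. real (stirling r k) / (fact (n + r - 1) * real n ^ (p + 1 - k)))"
proof -
  have "(fact (n + r - 1) :: real) = fact (n - 1) * pochhammer (real n) r"
    using pochhammer_product'[of "1 :: real" "n - 1" r] assms by (simp add: pochhammer_fact of_nat_diff)
  moreover have "(fact n :: real) = real n * fact (n - 1)"
    using assms by (simp add: fact_reduce)
  moreover have "pochhammer (real n) r = (\<Sum>k=1..r. real (stirling r k) * real n ^ k)"
    unfolding stirling_pochhammer[symmetric] using assms
    by (cases r) (auto simp: atMost_atLeast0 sum.atLeast_Suc_atMost simp del: stirling.simps(4) sum.cl_ivl_Suc)
  \<comment> \<open>The rising factorial of \<open>n\<close> is a quotient by
    \<open>(n - 1)!\<close>. Passing to \<open>n!\<close> costs a factor \<open>n\<close>, which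
    raises the exponent from \<open>p\<close> to \<open>p + 1\<close>.\<close>
  ultimately have "real n * fact (n + r - 1) = fact n * (\<Sum>k=1..r. real (stirling r k) * real n ^ k)"
    by simp
  moreover have "real (stirling r k) / (fact (n + r - 1) * real n ^ (p + 1 - k)) = 
      real (stirling r k) * real n ^ k / (fact (n + r - 1) * real n ^ (p + 1))" if "k \<in> {1..r}" for k
  proof -
    have "real n ^ (p + 1) = real n ^ k * real n ^ (p + 1 - k)"
      using that assms by (simp flip: power_add)
    then show ?thesis using assms by simp
  qed
  ultimately have "(\<Sum>k=1..r. real (stirling r k) / (fact (n + r - 1) * real n ^ (p + 1 - k))) =
      real n * fact (n + r - 1) / fact n / (fact (n + r - 1) * real n ^ (p + 1))"
    by (simp flip: sum_divide_distrib)
  then show ?thesis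
    using assms by (simp add: field_simps)
qed

lemma hyperharm_sum_conv_W:
  assumes "r \<ge> 1" "K \<ge> 1" "p \<ge> r + 1"
  shows "hyperharm_sum K r p = 1 / fact (r - 1) * (\<Sum>k=1..r. real (stirling r k) *
           (\<Sum>j\<le>K. fps_nth (harm_fps (r - 1)) j * (W (Suc K - j) (r - 1) (p + 1 - k) / fact (K - j))))"
proof -
  let ?c = "fps_nth (harm_fps (r - 1))"
  let ?w = "\<lambda>n j k. real (stirling (Suc n + (r - 1) + 1) (Suc K - j)) /
              (fact (Suc n + (r - 1)) * real (Suc n) ^ (p + 1 - k))"
  \<comment> \<open>Since \<open>k \<le> r\<close> and \<open>p \<ge> r + 1\<close>, every exponent
    \<open>p + 1 - k\<close> is at least 2. All the \<open>W\<close> series converge, and the finite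
    sums may be interchanged with the series.\<close>
  have "(\<lambda>n. 1 / fact (r - 1) * (\<Sum>k=1..r. real (stirling r k) * (\<Sum>j\<le>K. ?c j * ?w n j k))) sums
     (1 / fact (r - 1) * (\<Sum>k=1..r. real (stirling r k) *
           (\<Sum>j\<le>K. ?c j * (W (Suc K - j) (r - 1) (p + 1 - k) / fact (Suc K - j - 1)))))"
    using assms by (intro sums_mult sums_sum W_sums) auto
  moreover have "1 / fact (r - 1) * (\<Sum>k=1..r. real (stirling r k) * (\<Sum>j\<le>K. ?c j * ?w n j k)) =
      hyperharm (Suc n) r K / real (Suc n) ^ p" for n
  proof -
    let ?S = "\<Sum>j\<le>K. ?c j * real (stirling (Suc n + r) (Suc K - j))"
    have "hyperharm (Suc n) r K / real (Suc n) ^ p = 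
        1 / fact (r - 1) * (1 / (fact (Suc n) * real (Suc n) ^ p) * ?S)"
      using assms by (simp add: hyperharm_conv_stirling mult_ac del: of_nat_Suc fact_Suc)
    also have "1 / (fact (Suc n) * real (Suc n) ^ p) * ?S = 
       (\<Sum>k=1..r. real (stirling r k) / (fact (Suc n + r - 1) * real (Suc n) ^ (p + 1 - k)) * ?S)"
      unfolding sum_distrib_right[symmetric] using assms
      by (subst inverse_fact_conv_stirling[of r]) auto
    also have "\<dots> = (\<Sum>k=1..r. real (stirling r k) * (\<Sum>j\<le>K. ?c j * ?w n j k))"
      using assms by (simp add: sum_distrib_left mult_ac del: of_nat_Suc fact_Suc)
    finally show ?thesis ..
  qed
  ultimately show ?thesis
    unfolding hyperharm_sum_def by (simp add: sums_iff)
qed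

theorem theorem2p6:
  fixes r p :: nat
  assumes "r \<ge> 1" and "p \<ge> 1" and "p \<ge> r + 1"
  shows "hyperharm_sum 2 r p =
           1 / (fact 2 * fact (r - 1)) *
           (\<Sum>k=1..r. real (stirling r k) *
              (W 3 (r - 1) (p + 1 - k)
               - 2 * harm (r - 1) * W 2 (r - 1) (p + 1 - k)
               + (harm (r - 1) ^ 2 + gen_harm 2 (r - 1)) * zeta (real (p + 1 - k))))
       \<and> hyperharm_sum 3 r p =
           1 / (fact 3 * fact (r - 1)) *
           (\<Sum>k=1..r. real (stirling r k) *
              (W 4 (r - 1) (p + 1 - k)
               - 3 * harm (r - 1) * W 3 (r - 1) (p + 1 - k)
               + 3 * (harm (r - 1) ^ 2 + gen_harm 2 (r - 1)) * W 2 (r - 1) (p + 1 - k)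
               - (harm (r - 1) ^ 3 + 3 * harm (r - 1) * gen_harm 2 (r - 1)
                  + 2 * gen_harm 3 (r - 1)) * zeta (real (p + 1 - k))))"
proof
  \<comment> \<open>With \<open>1 / K!\<close> pulled out, the \<open>j\<close>-th coefficient is
    multiplied by \<open>K! / (K - j)!\<close>. This clears the denominators 2 and 6 of the harmonic
    polynomials; the last term \<open>j = K\<close> is \<open>W 1\<close>, a zeta value.\<close>
  have "(\<Sum>j\<le>2. fps_nth (harm_fps (r - 1)) j * (W (Suc 2 - j) (r - 1) m / fact (2 - j))) =
      1 / fact 2 * (W 3 (r - 1) m - 2 * harm (r - 1) * W 2 (r - 1) m
               + (harm (r - 1) ^ 2 + gen_harm 2 (r - 1)) * zeta (real m))" for m
  proof -
    have "{..2::nat} = {0, 1, 2}" by auto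
    then show ?thesis
      by (simp add: harm_fps_nth_1[unfolded One_nat_def] harm_fps_nth_2 W_1[unfolded One_nat_def] field_simps)
  qed
  then show "hyperharm_sum 2 r p =
           1 / (fact 2 * fact (r - 1)) *
           (\<Sum>k=1..r. real (stirling r k) *
              (W 3 (r - 1) (p + 1 - k)
               - 2 * harm (r - 1) * W 2 (r - 1) (p + 1 - k)
               + (harm (r - 1) ^ 2 + gen_harm 2 (r - 1)) * zeta (real (p + 1 - k))))"
    using assms by (simp only: hyperharm_sum_conv_W) (simp add: sum_distrib_left mult_ac)
  have "(\<Sum>j\<le>3. fps_nth (harm_fps (r - 1)) j * (W (Suc 3 - j) (r - 1) m / fact (3 - j))) =
      1 / fact 3 * (W 4 (r - 1) m - 3 * harm (r - 1) * W 3 (r - 1) m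
               + 3 * (harm (r - 1) ^ 2 + gen_harm 2 (r - 1)) * W 2 (r - 1) m
               - (harm (r - 1) ^ 3 + 3 * harm (r - 1) * gen_harm 2 (r - 1)
                  + 2 * gen_harm 3 (r - 1)) * zeta (real m))" for m
  proof -
    have "{..3::nat} = {0, 1, 2, 3}" by auto
    then show ?thesis
      by (simp add: harm_fps_nth_1[unfolded One_nat_def] harm_fps_nth_2 harm_fps_nth_3
                    W_1[unfolded One_nat_def] fact_numeral field_simps)
  qed
  then show "hyperharm_sum 3 r p =
           1 / (fact 3 * fact (r - 1)) *
           (\<Sum>k=1..r. real (stirling r k) *
              (W 4 (r - 1) (p + 1 - k)
               - 3 * harm (r - 1) * W 3 (r - 1) (p + 1 - k)
               + 3 * (harm (r - 1) ^ 2 + gen_harm 2 (r - 1)) * W 2 (r - 1) (p + 1 - k)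
               - (harm (r - 1) ^ 3 + 3 * harm (r - 1) * gen_harm 2 (r - 1)
                  + 2 * gen_harm 3 (r - 1)) * zeta (real (p + 1 - k))))"
    using assms by (simp only: hyperharm_sum_conv_W) (simp add: sum_distrib_left mult_ac)
qed

end
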